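(* Let $\varepsilon>0$, $\delta>0$, $\zeta_l>0$, $w_l\in\mathbb{R}$ and $s>0$ with $s>\sqrt{\zeta_l}+w_l/\zeta_l$ be such that $$\varepsilon^2\ <\ \frac{4\delta K_1^2}{3s^2}F'(\zeta_r)\,\zeta_r .$$ Let $(z,v)$ be the unique (up to translations in $\xi$) non-constant solution on $\mathbb{R}$ of the system $$z'=v,\qquad v'=-\frac{3}{K_1^2}F(e^z)-\frac{3c}{K_1^2}v$$ with $(z,v)\to(z_l,0)$ as $\xi\to-\infty$ and $(z,v)\to(z_r,0)$ as $\xi\to+\infty$. Then $z(\xi)>z_l$ for all $\xi\in\mathbb{R}$ and: (a) If $M_0=\sup_{\xi}z(\xi)$, then $M_0$ is attained at a unique value $\xi=\chi_0$, and $z'(\xi)>0$ for $\xi<\chi_0$. (b) There is $\xi_0<\chi_0$ such that $(\xi-\xi_0)z''(\xi)<0$ for all $\xi<\chi_0$, $\xi\neq\xi_0$. (c) The solution $z$ has an infinite number of local maxima and minima. These are taken on at points $\{\chi_i\}_{i=0}^\infty$ (maxima) and $\{\omega_i\}_{i=1}^\infty$ (minima), where $\chi_i<\omega_{i+1}<\chi_{i+1}$ for all $i\ge0$ and $\lim_{i\to\infty}\chi_i=\lim_{i\to\infty}\omega_i=\infty$. Moreover, $z_r<z(\chi_{i+1})<z(\chi_i)$ for all $i\ge 0$ and $z_r>z(\omega_{i+1})>z(\omega_i)$ for all $i\ge1$.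
   Context: Notation: $'=d/d\xi$ when applied to $z,v$, and $F'$ is the derivative of $F$ with respect to its argument; $c=s\varepsilon/\sqrt{\delta}$; $K_1=w_l-s\zeta_l<0$; $K_2=-sw_l+\frac{\zeta_l^2}{2}+\frac{w_l^2}{\zeta_l}$, so that $K_2-sK_1=\frac{K_1^2}{\zeta_l}+\frac{\zeta_l^2}{2}$. For $\zeta>0$, $$F(\zeta)=\frac{\zeta}{2}+\frac{K_1^2}{\zeta^2}-\frac{K_2-sK_1}{\zeta}=\frac{(\zeta-\zeta_l)(\zeta-\zeta_r)(\zeta+\zeta_l+\zeta_r)}{2\zeta^2},\qquad \zeta_r=-\frac{\zeta_l}{2}+\frac12\sqrt{\frac{8K_1^2+\zeta_l^3}{\zeta_l}} ,$$ and $F'(\zeta_r)=(\zeta_r^3-K_1^2)/\zeta_r^3>0$. Finally $z_l=\ln\zeta_l$, $z_r=\ln\zeta_r$. Under the stated assumptions on $\varepsilon,\delta,\zeta_l,w_l,s$ (without the condition on $\varepsilon^2$), such a solution $(z,v)$ exists and is unique up to translations in $\xi$. *)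

theory Defs
  imports "HOL-Analysis.Analysis"
begin

definition K1 :: "real \<Rightarrow> real \<Rightarrow> real \<Rightarrow> real" where
  "K1 \<zeta>l wl s = wl - s * \<zeta>l"

definition K2 :: "real \<Rightarrow> real \<Rightarrow> real \<Rightarrow> real" where
  "K2 \<zeta>l wl s = - s * wl + \<zeta>l\<^sup>2 / 2 + wl\<^sup>2 / \<zeta>l"

text \<open>Only the values at positive arguments are meaningful; the system below
  evaluates it at \<open>exp (z \<xi>)\<close>.\<close>

definition F :: "real \<Rightarrow> real \<Rightarrow> real \<Rightarrow> real \<Rightarrow> real" where
  "F \<zeta>l wl s \<zeta> =
     \<zeta> / 2 + (K1 \<zeta>l wl s)\<^sup>2 / \<zeta>\<^sup>2 - (K2 \<zeta>l wl s - s * K1 \<zeta>l wl s) / \<zeta>"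

definition zeta_r :: "real \<Rightarrow> real \<Rightarrow> real \<Rightarrow> real" where
  "zeta_r \<zeta>l wl s = - \<zeta>l / 2 + 1 / 2 * sqrt ((8 * (K1 \<zeta>l wl s)\<^sup>2 + \<zeta>l ^ 3) / \<zeta>l)"

definition wave_c :: "real \<Rightarrow> real \<Rightarrow> real \<Rightarrow> real" where
  "wave_c \<epsilon> \<delta> s = s * \<epsilon> / sqrt \<delta>"

definition wave_solution ::
    "real \<Rightarrow> real \<Rightarrow> real \<Rightarrow> real \<Rightarrow> real \<Rightarrow> (real \<Rightarrow> real) \<Rightarrow> (real \<Rightarrow> real) \<Rightarrow> bool" where
  "wave_solution \<epsilon> \<delta> \<zeta>l wl s z v \<longleftrightarrow>
     (\<forall>\<xi>. (z has_real_derivative v \<xi>) (at \<xi>)) \<and>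
     (\<forall>\<xi>. (v has_real_derivative
            (- (3 / (K1 \<zeta>l wl s)\<^sup>2) * F \<zeta>l wl s (exp (z \<xi>))
             - 3 * wave_c \<epsilon> \<delta> s / (K1 \<zeta>l wl s)\<^sup>2 * v \<xi>)) (at \<xi>))"

definition local_max_at :: "(real \<Rightarrow> real) \<Rightarrow> real \<Rightarrow> bool" where
  "local_max_at f x \<longleftrightarrow> (\<forall>\<^sub>F y in nhds x. f y \<le> f x)"

definition local_min_at :: "(real \<Rightarrow> real) \<Rightarrow> real \<Rightarrow> bool" where
  "local_min_at f x \<longleftrightarrow> (\<forall>\<^sub>F y in nhds x. f x \<le> f y)"

end

theory Submission
  imports Defs
begin

text \<open>The system is a damped oscillator \<open>z'' + b z' + g(z) = 0\<close>, where \<open>g\<close> first decreases and then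
  increases and vanishes exactly at \<open>z\<^sub>l < z\<^sub>r\<close>. The energy \<open>v\<^sup>2/2 + G(z)\<close> decreases strictly, which
  keeps the orbit above \<open>z\<^sub>l\<close> and orders the heights of successive extrema. The bound on \<open>\<epsilon>\<^sup>2\<close> says
  that \<open>b\<^sup>2 < 4 g'(z\<^sub>r)\<close>, so by Sturm comparison \<open>z - z\<^sub>r\<close> has arbitrarily large zeros. Since the orbit
  never meets an equilibrium, all zeros of \<open>v = z'\<close> are simple; they can be listed in increasing
  order and are alternately maxima and minima of \<open>z\<close>.\<close>

section \<open>Functions with simple zeros\<close>

lemma has_real_derivative_nonzero_isolated:
  fixes f :: "real \<Rightarrow> real"
  assumes "(f has_real_derivative l) (at x)" and "l \<noteq> 0" and "f x = 0"
  obtains d where "d > 0" and "\<And>t. t \<noteq> x \<Longrightarrow> \<bar>t - x\<bar> < d \<Longrightarrow> f t \<noteq> 0"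
proof -
  have "((\<lambda>t. (f t - f x) / (t - x)) \<longlongrightarrow> l) (at x)"
    using assms(1) by (simp add: has_field_derivative_iff)
  then have "\<forall>\<^sub>F t in at x. (f t - f x) / (t - x) \<noteq> 0"
    using assms(2) by (rule tendsto_imp_eventually_ne)
  then obtain d where "d > 0" "\<And>t. t \<noteq> x \<Longrightarrow> dist t x < d \<Longrightarrow> (f t - f x) / (t - x) \<noteq> 0"
    unfolding eventually_at by auto
  with assms(3) that[of d] show thesis
    by (auto simp: dist_real_def)
qed

text \<open>With a negative slope at \<open>b\<close> as well, \<open>f\<close> would be negative
  just after \<open>a\<close> and positive just before \<open>b\<close>, so the intermediate value
  theorem would give a zero in between. This produces the alternation of maxima and minima.\<close>

lemma next_zero_derivative_pos:
  fixes f :: "real \<Rightarrow> real"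
  assumes cont: "\<And>t. isCont f t"
    and a: "(f has_real_derivative l) (at a)" "l < 0" "f a = 0"
    and b: "(f has_real_derivative m) (at b)" "m \<noteq> 0" "f b = 0"
    and "a < b" and nz: "\<And>t. a < t \<Longrightarrow> t < b \<Longrightarrow> f t \<noteq> 0"
  shows "m > 0"
proof (rule ccontr)
  assume "\<not> m > 0"
  then have "m < 0" using b(2) by simp
  obtain d where d: "d > 0" "\<And>h. 0 < h \<Longrightarrow> h < d \<Longrightarrow> f (a + h) < f a"
    using DERIV_neg_dec_right[OF a(1,2)] by blast
  obtain e where e: "e > 0" "\<And>h. 0 < h \<Longrightarrow> h < e \<Longrightarrow> f b < f (b - h)"
    using DERIV_neg_dec_left[OF b(1) \<open>m < 0\<close>] by blast
  \<comment> \<open>The cap \<open>(b - a) / 3\<close> keeps \<open>p \<le> q\<close>; halving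
    \<open>d\<close> and \<open>e\<close> stays strictly inside the two neighbourhoods.\<close>
  define p where "p = a + min (d / 2) ((b - a) / 3)"
  define q where "q = b - min (e / 2) ((b - a) / 3)"
  have pq: "a < p" "p \<le> q" "q < b"
    using d(1) e(1) \<open>a < b\<close> by (auto simp: p_def q_def min_def field_simps)
  have "f p < 0" using d(2)[of "min (d / 2) ((b - a) / 3)"] d(1) \<open>a < b\<close> a(3)
    by (auto simp: p_def min_def)
  moreover have "f q > 0" using e(2)[of "min (e / 2) ((b - a) / 3)"] e(1) \<open>a < b\<close> b(3)
    by (auto simp: q_def min_def)
  ultimately obtain t where "p \<le> t" "t \<le> q" "f t = 0"
    using IVT[of f p 0 q] pq(2) cont by (meson less_imp_le)
  then show False using nz[of t] pq by auto
qed

section \<open>Nondegenerate critical points and local extrema\<close>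

lemma critical_point_strict_max:
  fixes f f' :: "real \<Rightarrow> real"
  assumes f: "\<And>x. (f has_real_derivative f' x) (at x)"
    and f': "(f' has_real_derivative l) (at t)" and "f' t = 0" and "l < 0"
  shows "\<forall>\<^sub>F x in at t. f x < f t"
proof -
  obtain d where d: "d > 0" "\<And>h. 0 < h \<Longrightarrow> h < d \<Longrightarrow> f' (t + h) < 0"
    using DERIV_neg_dec_right[OF f' \<open>l < 0\<close>] \<open>f' t = 0\<close> by auto
  obtain e where e: "e > 0" "\<And>h. 0 < h \<Longrightarrow> h < e \<Longrightarrow> f' (t - h) > 0"
    using DERIV_neg_dec_left[OF f' \<open>l < 0\<close>] \<open>f' t = 0\<close> by auto
  have cont: "continuous_on S f" for S
    using f by (auto intro!: continuous_at_imp_continuous_on DERIV_isCont)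
  have "f x < f t" if "x \<noteq> t" "dist x t < min d e" for x
  proof (cases "t < x")
    case True
    then show ?thesis
    proof (rule DERIV_neg_imp_decreasing_open)
      fix y assume "t < y" "y < x"
      then show "\<exists>l. (f has_real_derivative l) (at y) \<and> l < 0"
        using f[of y] d(2)[of "y - t"] that True by (auto simp: dist_real_def)
    qed (rule cont)
  next
    case False
    then have "x < t" using that by simp
    then show ?thesis
    proof (rule DERIV_pos_imp_increasing_open)
      fix y assume "x < y" "y < t"
      then show "\<exists>l. (f has_real_derivative l) (at y) \<and> 0 < l"
        using f[of y] e(2)[of "t - y"] that False by (auto simp: dist_real_def)
    qed (rule cont)
  qed
  then show ?thesis
    unfolding eventually_at using d(1) e(1) by (intro exI[of _ "min d e"]) auto
qed

lemma local_max_at_minus: "local_max_at (\<lambda>x. - f x) t \<longleftrightarrow> local_min_at f t"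
  by (simp add: local_max_at_def local_min_at_def)

lemma local_min_at_imp_not_strict_max:
  assumes "local_min_at f t" shows "\<not> (\<forall>\<^sub>F x in at t. f x < f t)"
proof
  assume "\<forall>\<^sub>F x in at t. f x < f t"
  moreover have "\<forall>\<^sub>F x in at t. f t \<le> f x"
    using assms by (simp add: local_min_at_def eventually_nhds_conv_at)
  ultimately have "\<forall>\<^sub>F x in at t. False" by eventually_elim simp
  then show False by simp
qed

text \<open>Because \<open>simple\<close> rules out degenerate critical points, the second
  derivative test becomes an equivalence: \<open>l > 0\<close> would make \<open>t\<close> a strict
  local minimum, which a weak local maximum cannot be.\<close>

lemma local_max_at_iff_critical:
  fixes f f' :: "real \<Rightarrow> real"
  assumes f: "\<And>x. (f has_real_derivative f' x) (at x)"
    and f': "(f' has_real_derivative l) (at t)" and simple: "f' t = 0 \<Longrightarrow> l \<noteq> 0"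
  shows "local_max_at f t \<longleftrightarrow> f' t = 0 \<and> l < 0"
proof (intro iffI conjI)
  assume max: "local_max_at f t"
  then obtain d where "d > 0" "\<And>y. \<bar>t - y\<bar> < d \<Longrightarrow> f y \<le> f t"
    unfolding local_max_at_def eventually_nhds_metric by (auto simp: dist_real_def abs_minus_commute)
  then show zero: "f' t = 0" using DERIV_local_max[OF f] by blast
  have "\<not> - l < 0"
  proof
    assume "- l < 0"
    then have "\<forall>\<^sub>F x in at t. - f x < - f t"
      using zero by (intro critical_point_strict_max[where f' = "\<lambda>x. - f' x" and l = "- l"])
        (auto intro!: DERIV_minus f f')
    then show False
      using local_min_at_imp_not_strict_max[of "\<lambda>x. - f x" t] max
      by (simp add: local_min_at_def local_max_at_def)
  qed
  then show "l < 0" using simple[OF zero] by simp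
next
  assume "f' t = 0 \<and> l < 0"
  then have "\<forall>\<^sub>F x in at t. f x < f t"
    using critical_point_strict_max[OF f f'] by blast
  then show "local_max_at f t"
    unfolding local_max_at_def eventually_nhds_conv_at by (auto elim: eventually_mono)
qed

lemma local_min_at_iff_critical:
  fixes f f' :: "real \<Rightarrow> real"
  assumes f: "\<And>x. (f has_real_derivative f' x) (at x)"
    and f': "(f' has_real_derivative l) (at t)" and simple: "f' t = 0 \<Longrightarrow> l \<noteq> 0"
  shows "local_min_at f t \<longleftrightarrow> f' t = 0 \<and> l > 0"
  using local_max_at_iff_critical[OF DERIV_minus[OF f] DERIV_minus[OF f']] simple
  by (simp add: local_max_at_minus)

text \<open>Simple zeros are isolated and form a closed set, so there is a least one and each has a
  successor; iterating the successor reaches them all. The slopes alternate, starting negative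
  because \<open>f\<close> is positive before the first zero.\<close>

lemma simple_zeros_enumeration:
  fixes f f' :: "real \<Rightarrow> real"
  assumes der: "\<And>t. (f has_real_derivative f' t) (at t)"
    and simple: "\<And>t. f t = 0 \<Longrightarrow> f' t \<noteq> 0"
    and pos: "\<And>t. t < T \<Longrightarrow> f t > 0"
    and unbdd: "\<And>t. \<exists>u>t. f u = 0"
  obtains c :: "nat \<Rightarrow> real" where "strict_mono c" and "filterlim c at_top sequentially"
    and "range c = {t. f t = 0}" and "\<And>t. t < c 0 \<Longrightarrow> f t > 0"
    and "\<And>n. even n \<Longrightarrow> f' (c n) < 0" and "\<And>n. odd n \<Longrightarrow> f' (c n) > 0"
proof -
  have cont: "isCont f t" for t using der by (rule DERIV_isCont)
  have cl: "closed {t. f t = 0}"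
    using cont by (intro closed_Collect_eq continuous_at_imp_continuous_on) auto
  have "\<exists>u>t. f u = 0 \<and> (\<forall>x. t < x \<and> x < u \<longrightarrow> f x \<noteq> 0)" if t: "f t = 0" for t
  proof -
    obtain d where d: "d > 0" "\<And>x. x \<noteq> t \<Longrightarrow> \<bar>x - t\<bar> < d \<Longrightarrow> f x \<noteq> 0"
      using has_real_derivative_nonzero_isolated[OF der simple[OF t] t] by blast
    \<comment> \<open>Isolation of \<open>t\<close> lets the open condition \<open>x > t\<close> be
      replaced by the closed one \<open>x \<ge> t + d\<close>, so the infimum of the later zeros is
      itself a zero.\<close>
    define S where "S = {x. f x = 0} \<inter> {t + d..}"
    have S: "S = {x. t < x \<and> f x = 0}"
    proof -
      have "t + d \<le> x" if "t < x" "f x = 0" for x using d(2)[of x] that by fastforce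
      then show ?thesis using d(1) unfolding S_def by force
    qed
    have "S \<noteq> {}" "bdd_below S" "closed S"
      using unbdd[of t] S apply blast
      using S_def cl by (auto simp: closed_Int)
    then have "Inf S \<in> S" by (intro closed_contains_Inf)
    moreover have "x \<notin> S" if "x < Inf S" for x
      using that \<open>bdd_below S\<close> cInf_lower[of x S] by auto
    ultimately show ?thesis unfolding S by blast
  qed
  then obtain nxt where nxt: "\<And>t. f t = 0 \<Longrightarrow> nxt t > t" "\<And>t. f t = 0 \<Longrightarrow> f (nxt t) = 0"
    "\<And>t x. f t = 0 \<Longrightarrow> t < x \<Longrightarrow> x < nxt t \<Longrightarrow> f x \<noteq> 0"
    by metis
  define c0 where "c0 = Inf {t. f t = 0}"
  have bb: "bdd_below {t. f t = 0}"
    using pos by (intro bdd_belowI[of _ T]) (force simp: not_less[symmetric])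
  have c0: "f c0 = 0"
    using closed_contains_Inf[OF _ bb cl] unbdd unfolding c0_def by blast
  have c0_le: "c0 \<le> t" if "f t = 0" for t
    unfolding c0_def using bb that by (intro cInf_lower) auto
  have before: "f t > 0" if "t < c0" for t
  proof (rule ccontr)
    assume "\<not> f t > 0"
    \<comment> \<open>A point to the left of both \<open>t\<close> and \<open>T\<close>, where
      positivity is known, serves as the starting point for the intermediate value theorem.\<close>
    moreover have "f (min t T - 1) > 0" by (rule pos) auto
    ultimately have "\<exists>x\<ge>min t T - 1. x \<le> t \<and> f x = 0"
      using cont by (intro IVT2) auto
    then obtain x where "x \<le> t" "f x = 0" by blast
    then show False using c0_le that by force
  qed
  define c where "c = rec_nat c0 (\<lambda>_. nxt)"
  have c_simps: "c 0 = c0" "c (Suc n) = nxt (c n)" for n by (auto simp: c_def)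
  have c_zero: "f (c n) = 0" for n by (induction n) (auto simp: c_simps c0 nxt(2))
  have mono: "strict_mono c"
    by (rule strict_monoI_Suc) (simp add: c_simps nxt(1) c_zero)
  have top: "filterlim c at_top sequentially"
  proof (rule ccontr)
    \<comment> \<open>Otherwise the zeros would increase to a finite limit, which is a zero by
      continuity but not an isolated one.\<close>
    assume "\<not> filterlim c at_top sequentially"
    then obtain B where "\<not> (\<forall>\<^sub>F n in sequentially. B \<le> c n)"
      unfolding filterlim_at_top by blast
    then have B: "c n \<le> B" for n
      unfolding eventually_sequentially
      by (metis mono strict_mono_less_eq linorder_le_cases order_trans)
    obtain L where L: "c \<longlonglongrightarrow> L" "\<And>n. c n \<le> L"
      using incseq_convergent[of c B] strict_mono_mono[OF mono] B by blast
    have "(\<lambda>n. f (c n)) \<longlonglongrightarrow> f L" using L(1) cont by (rule isCont_tendsto_compose[rotated])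
    then have "f L = 0" by (simp add: c_zero LIMSEQ_const_iff)
    then obtain d where d: "d > 0" "\<And>x. x \<noteq> L \<Longrightarrow> \<bar>x - L\<bar> < d \<Longrightarrow> f x \<noteq> 0"
      using has_real_derivative_nonzero_isolated[OF der simple] by blast
    have "\<forall>\<^sub>F n in sequentially. c n > L - d"
      using order_tendstoD(1)[OF L(1)] d(1) by auto
    then obtain n where "c n > L - d" using eventually_happens by force
    moreover have "c n < L" using strict_monoD[OF mono, of n "Suc n"] L(2)[of "Suc n"] by simp
    ultimately show False using d(2)[of "c n"] c_zero by auto
  qed
  have "x \<in> range c" if x: "f x = 0" for x
  proof -
    obtain n where "x < c n"
      using top unfolding filterlim_at_top_dense eventually_sequentially by blast
    \<comment> \<open>The first listed zero beyond \<open>x\<close> is not \<open>c 0\<close>, the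
      least zero, so \<open>x\<close> lies between \<open>c m\<close> and its successor, where
      \<open>c m\<close> is the only zero.\<close>
    define k where "k = (LEAST n. x < c n)"
    have k: "x < c k" unfolding k_def using \<open>x < c n\<close> by (rule LeastI)
    obtain m where m: "k = Suc m" using k c0_le[OF x] by (cases k) (auto simp: c_simps)
    have "c m \<le> x" using not_less_Least[of m "\<lambda>n. x < c n"] m unfolding k_def by auto
    then have "x = c m" using nxt(3)[OF c_zero, of m x] k m x by (force simp: c_simps)
    then show ?thesis by blast
  qed
  then have rng: "range c = {t. f t = 0}" using c_zero by auto
  have neg0: "f' c0 < 0"
  proof (rule ccontr)
    assume "\<not> f' c0 < 0"
    then have "f' c0 > 0" using simple[OF c0] by simp
    then obtain d where "d > 0" "\<And>h. 0 < h \<Longrightarrow> h < d \<Longrightarrow> f (c0 - h) < f c0"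
      using DERIV_pos_inc_left[OF der] by blast
    then have "f (c0 - d / 2) < 0" using c0 by simp
    then show False using before[of "c0 - d / 2"] \<open>d > 0\<close> by simp
  qed
  have signs: "if even n then f' (c n) < 0 else f' (c n) > 0" for n
  proof (induction n)
    case 0
    show ?case using neg0 by (simp add: c_simps)
  next
    case (Suc n)
    have gap: "c n < c (Suc n)" "\<And>t. c n < t \<Longrightarrow> t < c (Suc n) \<Longrightarrow> f t \<noteq> 0"
      using nxt(1,3)[OF c_zero] by (auto simp: c_simps)
    show ?case
    proof (cases "even n")
      case True
      then show ?thesis
        using next_zero_derivative_pos[OF cont der _ c_zero der simple c_zero gap] Suc c_zero by simp
    next
      case False
      \<comment> \<open>After an upward crossing the same lemma is applied to
        \<open>- f\<close>.\<close>
      have "- f' (c (Suc n)) > 0"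
        using gap False Suc c_zero simple
        by (intro next_zero_derivative_pos[of "\<lambda>t. - f t" "- f' (c n)" "c n" _ "c (Suc n)"])
          (auto intro!: DERIV_minus der cont continuous_minus)
      then show ?thesis using False by simp
    qed
  qed
  show thesis
  proof (rule that[OF mono top rng])
    show "\<And>t. t < c 0 \<Longrightarrow> f t > 0" using before by (simp add: c_simps)
  qed (use signs in presburger)+
qed

section \<open>Linear second-order equations\<close>

text \<open>The weight \<open>exp (- C * t)\<close> makes \<open>W\<close> nonincreasing forward in
  time, and \<open>exp (C * t)\<close> does the same backward; so \<open>W u\<close> is squeezed
  between 0 and a multiple of \<open>W a = 0\<close> on either side of \<open>a\<close>.\<close>

lemma gronwall_zero:
  fixes W W' :: "real \<Rightarrow> real"
  assumes der: "\<And>t. (W has_real_derivative W' t) (at t)"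
    and bound: "\<And>t. t \<in> {min a u..max a u} \<Longrightarrow> \<bar>W' t\<bar> \<le> C * W t"
    and nonneg: "\<And>t. W t \<ge> 0" and "W a = 0"
  shows "W u = 0"
proof (cases "a \<le> u")
  case True
  have "W u * exp (- C * u) \<le> W a * exp (- C * a)"
  proof (rule DERIV_nonpos_imp_nonincreasing[OF True])
    fix t assume "a \<le> t" "t \<le> u"
    then have "W' t - C * W t \<le> 0" using bound[of t] by auto
    moreover have "((\<lambda>t. W t * exp (- C * t)) has_real_derivative (W' t - C * W t) * exp (- C * t)) (at t)"
      by (auto intro!: derivative_eq_intros der simp: algebra_simps)
    ultimately show "\<exists>y. ((\<lambda>t. W t * exp (- C * t)) has_real_derivative y) (at t) \<and> y \<le> 0"
      by (meson exp_ge_zero mult_nonpos_nonneg)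
  qed
  then show ?thesis using \<open>W a = 0\<close> nonneg[of u] by (simp add: mult_le_0_iff)
next
  case False
  then have "u \<le> a" by simp
  then have "W u * exp (C * u) \<le> W a * exp (C * a)"
  proof (rule DERIV_nonneg_imp_nondecreasing)
    fix t assume "u \<le> t" "t \<le> a"
    then have "W' t + C * W t \<ge> 0" using bound[of t] by auto
    moreover have "((\<lambda>t. W t * exp (C * t)) has_real_derivative (W' t + C * W t) * exp (C * t)) (at t)"
      by (auto intro!: derivative_eq_intros der simp: algebra_simps)
    ultimately show "\<exists>y. ((\<lambda>t. W t * exp (C * t)) has_real_derivative y) (at t) \<and> 0 \<le> y"
      by (meson exp_ge_zero mult_nonneg_nonneg)
  qed
  then show ?thesis using \<open>W a = 0\<close> nonneg[of u] by (simp add: mult_le_0_iff)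
qed

text \<open>Gronwall's argument for the squared norm of \<open>(y, v)\<close>; \<open>Q\<close> is
  bounded on the compact interval between \<open>a\<close> and \<open>u\<close>.\<close>

lemma linear_ode_unique_zero:
  fixes y v Q :: "real \<Rightarrow> real"
  assumes y: "\<And>t. (y has_real_derivative v t) (at t)"
    and v: "\<And>t. (v has_real_derivative - Q t * y t - b * v t) (at t)"
    and Q: "\<And>t. isCont Q t" and "y a = 0" and "v a = 0"
  shows "y u = 0"
proof -
  define W where "W t = (y t)\<^sup>2 + (v t)\<^sup>2" for t
  define W' where "W' t = (1 - Q t) * (2 * (y t * v t)) - 2 * b * (v t)\<^sup>2" for t
  have "bounded (Q ` {min a u..max a u})"
    using Q by (intro compact_imp_bounded compact_continuous_image continuous_at_imp_continuous_on) auto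
  then obtain B where B: "\<And>t. t \<in> {min a u..max a u} \<Longrightarrow> \<bar>Q t\<bar> \<le> B"
    unfolding bounded_iff by (metis imageI real_norm_def)
  have "W u = 0"
  \<comment> \<open>In the constant, \<open>1 + B\<close> bounds \<open>\<bar>1 - Q t\<bar>\<close>,
    which multiplies \<open>2 * \<bar>y t * v t\<bar> \<le> W t\<close>; the damping term
    contributes \<open>2 * \<bar>b\<bar>\<close>.\<close>
  proof (rule gronwall_zero[where W = W and u = u and a = a and W' = W' and C = "1 + B + 2 * \<bar>b\<bar>"])
    show "(W has_real_derivative W' t) (at t)" for t
      unfolding W_def W'_def
      by (auto intro!: derivative_eq_intros y v simp: algebra_simps power2_eq_square)
    show "\<bar>W' t\<bar> \<le> (1 + B + 2 * \<bar>b\<bar>) * W t" if "t \<in> {min a u..max a u}" for t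
    proof -
      have yv: "2 * \<bar>y t * v t\<bar> \<le> W t"
        using sum_squares_bound[of "\<bar>y t\<bar>" "\<bar>v t\<bar>"] by (simp add: W_def abs_mult)
      have "\<bar>W' t\<bar> \<le> \<bar>1 - Q t\<bar> * (2 * \<bar>y t * v t\<bar>) + 2 * \<bar>b\<bar> * (v t)\<^sup>2"
        unfolding W'_def by (rule order_trans[OF abs_triangle_ineq4]) (simp add: abs_mult)
      also have "\<dots> \<le> (1 + B) * W t + 2 * \<bar>b\<bar> * W t"
      proof (intro add_mono mult_mono yv)
        show "\<bar>1 - Q t\<bar> \<le> 1 + B" "0 \<le> 1 + B" using B[OF that] by auto
      qed (auto simp: W_def)
      finally show ?thesis by (simp add: algebra_simps)
    qed
  qed (use assms in \<open>auto simp: W_def\<close>)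
  then show ?thesis by (simp add: W_def sum_power2_eq_zero_iff)
qed

text \<open>Sturm comparison with \<open>exp (- b t / 2) sin (\<omega> (t - T))\<close>: the Wronskian below decreases
  although its values at the two end points have the opposite order.\<close>

lemma sturm_not_positive:
  fixes y v Q :: "real \<Rightarrow> real"
  assumes y: "\<And>t. (y has_real_derivative v t) (at t)"
    and v: "\<And>t. (v has_real_derivative - Q t * y t - b * v t) (at t)"
    and "\<omega> > 0" and Q: "\<And>t. t \<in> {T..T + pi / \<omega>} \<Longrightarrow> b\<^sup>2 / 4 + \<omega>\<^sup>2 \<le> Q t"
  shows "\<exists>t\<in>{T..T + pi / \<omega>}. y t \<le> 0"
proof (rule ccontr)
  assume "\<not> ?thesis"
  then have pos: "y t > 0" if "t \<in> {T..T + pi / \<omega>}" for t using that by force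
  define f where "f t = exp (b * t / 2) *
    ((v t + b / 2 * y t) * sin (\<omega> * (t - T)) - \<omega> * y t * cos (\<omega> * (t - T)))" for t
  have der: "(f has_real_derivative
      - (exp (b * t / 2) * sin (\<omega> * (t - T)) * y t * (Q t - (b\<^sup>2 / 4 + \<omega>\<^sup>2)))) (at t)" for t
    unfolding f_def
    by (auto intro!: derivative_eq_intros y v simp: field_simps power2_eq_square)
  have "T \<le> T + pi / \<omega>" using \<open>\<omega> > 0\<close> by simp
  then have "f (T + pi / \<omega>) \<le> f T"
  proof (rule DERIV_nonpos_imp_nonincreasing)
    fix t assume t: "T \<le> t" "t \<le> T + pi / \<omega>"
    have "0 \<le> sin (\<omega> * (t - T))"
      using t \<open>\<omega> > 0\<close> by (intro sin_ge_zero) (auto simp: field_simps)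
    then have "0 \<le> exp (b * t / 2) * sin (\<omega> * (t - T)) * y t * (Q t - (b\<^sup>2 / 4 + \<omega>\<^sup>2))"
      using Q[of t] pos[of t] t by (intro mult_nonneg_nonneg) auto
    then show "\<exists>l. (f has_real_derivative l) (at t) \<and> l \<le> 0" using der by force
  qed
  \<comment> \<open>At both end points the sine vanishes, while the cosine is 1 at the left and -1
    at the right.\<close>
  moreover have "f T < 0" "f (T + pi / \<omega>) > 0"
    using pos[of T] pos[of "T + pi / \<omega>"] \<open>\<omega> > 0\<close> by (auto simp: f_def)
  ultimately show False by simp
qed

text \<open>Both \<open>y\<close> and \<open>- y\<close> solve the linear equation, so neither stays
  positive throughout the window; continuity then gives a zero.\<close>

lemma sturm_zero:
  fixes y v Q :: "real \<Rightarrow> real"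
  assumes y: "\<And>t. (y has_real_derivative v t) (at t)"
    and v: "\<And>t. (v has_real_derivative - Q t * y t - b * v t) (at t)"
    and "\<omega> > 0" and Q: "\<And>t. t \<in> {T..T + pi / \<omega>} \<Longrightarrow> b\<^sup>2 / 4 + \<omega>\<^sup>2 \<le> Q t"
  shows "\<exists>t\<ge>T. y t = 0"
proof -
  obtain p where p: "p \<ge> T" "y p \<le> 0"
    using sturm_not_positive[OF assms] by (meson atLeastAtMost_iff)
  have "\<exists>t\<in>{T..T + pi / \<omega>}. - y t \<le> 0"
    by (rule sturm_not_positive[where v = "\<lambda>t. - v t" and Q = Q and b = b])
      (auto intro!: derivative_eq_intros y v assms)
  then obtain q where q: "q \<ge> T" "y q \<ge> 0" by auto
  have "isCont y t" for t using y by (rule DERIV_isCont)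
  then show ?thesis
    using p q IVT[of y p 0 q] IVT2[of y p 0 q] by (cases "p \<le> q") (metis order_trans linorder_le_cases)+
qed

lemma increasing_from_bot_pos:
  fixes f f' :: "real \<Rightarrow> real"
  assumes der: "\<And>t. (f has_real_derivative f' t) (at t)"
    and pos: "\<And>t. t < T \<Longrightarrow> f' t > 0" and lim: "(f \<longlongrightarrow> 0) at_bot" and "t \<le> T"
  shows "f t > 0"
proof -
  have incr: "f x < f t" if "x < t" "t \<le> T" for x t
    using that pos der
    by (intro DERIV_pos_imp_increasing_open[OF that(1)] continuous_at_imp_continuous_on)
      (fastforce intro: DERIV_isCont)+
  \<comment> \<open>The limit only yields the weak bound \<open>0 \<le> f (t - 1)\<close>; the
    strict growth from \<open>t - 1\<close> to \<open>t\<close> makes it strict.\<close>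
  have "\<forall>\<^sub>F x in at_bot. f x \<le> f (t - 1)"
    using eventually_le_at_bot[of "t - 2"] by eventually_elim (use \<open>t \<le> T\<close> in \<open>auto intro!: less_imp_le incr\<close>)
  then have "0 \<le> f (t - 1)" by (intro tendsto_upperbound[OF lim]) auto
  then show ?thesis using incr[of "t - 1" t] \<open>t \<le> T\<close> by simp
qed

section \<open>Heteroclinic orbits of a damped oscillator\<close>

text \<open>\<open>G\<close> is the potential of the restoring force and \<open>zm\<close> the
  turning point of \<open>g\<close>. The assumption \<open>underdamped\<close> says that the
  characteristic polynomial \<open>X^2 + b X + g' zr\<close> at the right equilibrium has non-real
  roots, so this equilibrium is a focus.\<close>

locale damped_heteroclinic =
  fixes g g' G :: "real \<Rightarrow> real" and b zl zm zr :: real and z v :: "real \<Rightarrow> real"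
  assumes g_deriv: "\<And>x. (g has_real_derivative g' x) (at x)"
    and G_deriv: "\<And>x. (G has_real_derivative g x) (at x)"
    and g'_neg: "\<And>x. x < zm \<Longrightarrow> g' x < 0"
    and g'_pos: "\<And>x. x > zm \<Longrightarrow> g' x > 0"
    and g_zl: "g zl = 0" and g_zr: "g zr = 0"
    and zl_less_zm: "zl < zm" and zm_less_zr: "zm < zr"
    and b_pos: "b > 0" and underdamped: "b\<^sup>2 < 4 * g' zr"
    and z_deriv: "\<And>t. (z has_real_derivative v t) (at t)"
    and v_deriv: "\<And>t. (v has_real_derivative - g (z t) - b * v t) (at t)"
    and z_bot: "(z \<longlongrightarrow> zl) at_bot" and v_bot: "(v \<longlongrightarrow> 0) at_bot"
    and z_top: "(z \<longlongrightarrow> zr) at_top"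
begin

section \<open>Signs of \<open>g\<close> and monotonicity of its potential\<close>

lemma isCont_g: "isCont g x"
  using g_deriv by (rule DERIV_isCont)

lemma isCont_G: "isCont G x"
  using G_deriv by (rule DERIV_isCont)

lemma isCont_z: "isCont z t"
  using z_deriv by (rule DERIV_isCont)

lemma g_decreasing:
  assumes "x < y" "y \<le> zm" shows "g y < g x"
proof (rule DERIV_neg_imp_decreasing_open[OF assms(1)])
  show "\<exists>l. (g has_real_derivative l) (at u) \<and> l < 0" if "u < y" for u
    using g_deriv g'_neg[of u] that assms(2) by (meson less_le_trans)
qed (auto intro: continuous_at_imp_continuous_on isCont_g)

lemma g_increasing:
  assumes "x < y" "zm \<le> x" shows "g x < g y"
proof (rule DERIV_pos_imp_increasing_open[OF assms(1)])
  show "\<exists>l. (g has_real_derivative l) (at u) \<and> l > 0" if "x < u" for u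
    using g_deriv g'_pos[of u] that assms(2) by (meson le_less_trans)
qed (auto intro: continuous_at_imp_continuous_on isCont_g)

lemma g_neg: "zl < x \<Longrightarrow> x < zr \<Longrightarrow> g x < 0"
  using g_decreasing[of zl x] g_increasing[of x zr] g_zl g_zr by (cases "x \<le> zm") auto

lemma g_pos: "zr < x \<Longrightarrow> g x > 0"
  using g_increasing[of zr x] g_zr zm_less_zr by simp

lemma G_decreasing:
  assumes "x < y" "zl \<le> x" "y \<le> zr" shows "G y < G x"
proof (rule DERIV_neg_imp_decreasing_open[OF assms(1)])
  show "\<exists>l. (G has_real_derivative l) (at u) \<and> l < 0" if "x < u" "u < y" for u
    using G_deriv g_neg[of u] that assms(2,3) by (meson le_less_trans less_le_trans)
qed (auto intro: continuous_at_imp_continuous_on isCont_G)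

lemma G_increasing:
  assumes "x < y" "zr \<le> x" shows "G x < G y"
proof (rule DERIV_pos_imp_increasing_open[OF assms(1)])
  show "\<exists>l. (G has_real_derivative l) (at u) \<and> l > 0" if "x < u" for u
    using G_deriv g_pos[of u] that assms(2) by (meson le_less_trans)
qed (auto intro: continuous_at_imp_continuous_on isCont_G)

text \<open>Around an equilibrium \<open>p\<close> the system is linear in \<open>z - p\<close>, with a coefficient that depends
  continuously on time. This serves both uniqueness and Sturm comparison.\<close>

lemma linearization:
  assumes "g p = 0"
  obtains Q where "\<And>t. isCont (\<lambda>t. Q (z t)) t" and "isCont Q p" and "Q p = g' p"
    and "\<And>t. (v has_real_derivative - Q (z t) * (z t - p) - b * v t) (at t)"
proof -
  \<comment> \<open>Caratheodory's form of the derivative: \<open>Q\<close> is the difference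
    quotient of \<open>g\<close> at \<open>p\<close>, continued by \<open>g' p\<close>.\<close>
  obtain Q where Q0: "\<forall>x. g x - g p = Q x * (x - p)" and Q1: "isCont Q p" "Q p = g' p"
    using g_deriv[of p] unfolding CARAT_DERIV by blast
  have Q: "g x = Q x * (x - p)" for x
    using Q0 assms by (metis diff_zero)
  have "isCont Q x" for x
  proof (cases "x = p")
    case False
    \<comment> \<open>Away from \<open>p\<close> the function \<open>Q\<close> agrees locally with
      an explicit continuous quotient.\<close>
    have "\<forall>\<^sub>F u in nhds x. u \<noteq> p" using False by (rule t1_space_nhds)
    then have "\<forall>\<^sub>F u in nhds x. Q u = g u / (u - p)"
      by eventually_elim (simp add: Q)
    moreover have "isCont (\<lambda>u. g u / (u - p)) x"
      using False isCont_g by (intro continuous_intros) auto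
    ultimately show ?thesis by (simp add: isCont_cong)
  qed (use Q1 in simp)
  then have "isCont (\<lambda>t. Q (z t)) t" for t
    by (rule isCont_o2[OF isCont_z])
  moreover have "(v has_real_derivative - Q (z t) * (z t - p) - b * v t) (at t)" for t
    using v_deriv[of t] by (simp add: Q[symmetric])
  ultimately show thesis using Q1 that by blast
qed

text \<open>By uniqueness, an orbit that meets an equilibrium is constant, which contradicts the
  distinct limits \<open>zl\<close> and \<open>zr\<close>.\<close>

lemma no_equilibrium:
  assumes "v t = 0"
  shows "g (z t) \<noteq> 0"
proof
  assume eq: "g (z t) = 0"
  obtain Q where Q: "\<And>u. isCont (\<lambda>t. Q (z t)) u"
    "\<And>u. (v has_real_derivative - Q (z u) * (z u - z t) - b * v u) (at u)"
    using linearization[OF eq] by metis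
  have "z u - z t = 0" for u
    by (rule linear_ode_unique_zero[where y = "\<lambda>u. z u - z t" and v = v and a = t and b = b, OF _ Q(2) Q(1)])
      (auto intro!: derivative_eq_intros z_deriv assms)
  then have "(z \<longlongrightarrow> z t) F" for F
    by (intro tendsto_eventually always_eventually) simp
  then have "z t = zl" "z t = zr"
    using tendsto_unique[OF _ _ z_bot] tendsto_unique[OF _ _ z_top] by auto
  then show False using zl_less_zm zm_less_zr by simp
qed

section \<open>Decay of the energy and the lower bound \<open>zl\<close>\<close>

definition energy :: "real \<Rightarrow> real" where
  "energy t = (v t)\<^sup>2 / 2 + G (z t)"

lemma energy_deriv: "(energy has_real_derivative - b * (v t)\<^sup>2) (at t)"
proof -
  have "((\<lambda>t. (v t)\<^sup>2 / 2 + G (z t)) has_real_derivative - b * (v t)\<^sup>2) (at t)"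
    by (auto intro!: derivative_eq_intros v_deriv DERIV_chain2[OF G_deriv z_deriv]
        simp: field_simps power2_eq_square)
  then show ?thesis unfolding energy_def .
qed

text \<open>The derivative \<open>- b * (v t)\<^sup>2\<close> gives weak decrease. Equality would
  force \<open>v = 0\<close> on an interval, hence \<open>v' = 0\<close> there, and the orbit would
  meet an equilibrium.\<close>

lemma energy_decreasing:
  assumes "t < u"
  shows "energy u < energy t"
proof -
  have mono: "energy y \<le> energy x" if "x \<le> y" for x y
    by (rule DERIV_nonpos_imp_nonincreasing[OF that]) (use energy_deriv b_pos in force)
  have "energy u \<noteq> energy t"
  proof
    assume eq: "energy u = energy t"
    have v0: "v x = 0" if x: "t < x" "x < u" for x
    proof -
      have const: "energy y = energy t" if "t < y" "y < u" for y
        using mono[of t y] mono[of y u] that eq by simp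
      have "\<forall>\<^sub>F y in nhds x. y \<in> {t<..<u}"
        using x by (intro eventually_nhds_in_open) auto
      then have "\<forall>\<^sub>F y in nhds x. energy y = energy t"
        by eventually_elim (simp add: const)
      then have "(energy has_real_derivative 0) (at x)"
        by (subst DERIV_cong_ev[OF refl _ refl]) auto
      then show ?thesis using DERIV_unique[OF energy_deriv] b_pos by fastforce
    qed
    define x where "x = (t + u) / 2"
    have x: "t < x" "x < u" using assms by (auto simp: x_def)
    have "\<forall>\<^sub>F y in nhds x. y \<in> {t<..<u}"
      using x by (intro eventually_nhds_in_open) auto
    then have "\<forall>\<^sub>F y in nhds x. v y = 0"
      by eventually_elim (simp add: v0)
    then have "(v has_real_derivative 0) (at x)"
      by (subst DERIV_cong_ev[OF refl _ refl]) auto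
    then show False
      using DERIV_unique[OF v_deriv] v0[OF x] no_equilibrium[of x] by fastforce
  qed
  then show ?thesis using mono[of t u] assms by simp
qed

text \<open>\<open>G zl\<close> is the limit of the energy at minus infinity; comparing through
  \<open>t - 1\<close> keeps the inequality strict.\<close>

lemma energy_less: "energy t < G zl"
proof -
  have "(energy \<longlongrightarrow> 0\<^sup>2 / 2 + G zl) at_bot"
    unfolding energy_def
    by (intro tendsto_intros v_bot isCont_tendsto_compose[OF isCont_G] z_bot) simp_all
  moreover have "\<forall>\<^sub>F x in at_bot. energy (t - 1) \<le> energy x"
    using eventually_le_at_bot[of "t - 2"] by eventually_elim (auto intro!: less_imp_le energy_decreasing)
  ultimately have "energy (t - 1) \<le> G zl"
    by (intro tendsto_lowerbound) auto
  then show ?thesis using energy_decreasing[of "t - 1" t] by simp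
qed

text \<open>Since \<open>z\<close> ends up above \<open>zl\<close>, reaching or passing below
  \<open>zl\<close> would give a point with \<open>z = zl\<close>, where the energy is at least
  \<open>G zl\<close>.\<close>

lemma z_greater: "z t > zl"
proof (rule ccontr)
  assume "\<not> z t > zl"
  moreover have "\<forall>\<^sub>F u in at_top. z u > zl \<and> u \<ge> t"
    using order_tendstoD(1)[OF z_top, of zl] zl_less_zm zm_less_zr eventually_ge_at_top[of t]
    by (auto intro: eventually_conj)
  then obtain u where "z u > zl" "u \<ge> t"
    using eventually_happens by fastforce
  ultimately have "\<exists>x\<ge>t. x \<le> u \<and> z x = zl"
    using isCont_z by (intro IVT) auto
  then obtain x where "z x = zl" by blast
  then show False using energy_less[of x] by (simp add: energy_def)
qed

section \<open>Monotone start and oscillation about \<open>zr\<close>\<close>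

lemma exp_scaled_bot: "((\<lambda>t. exp (b * t)) \<longlongrightarrow> 0) at_bot"
  by (rule filterlim_compose[OF exp_at_bot filterlim_tendsto_pos_mult_at_bot[OF tendsto_const b_pos filterlim_ident]])

text \<open>The integrating factor \<open>exp (b * t)\<close> absorbs the damping: the product with
  \<open>v\<close> starts from 0 at minus infinity and increases as long as
  \<open>g (z t) < 0\<close>.\<close>

lemma v_pos_before:
  assumes below: "\<And>u. u < T \<Longrightarrow> z u < zr" and "t \<le> T"
  shows "v t > 0"
proof -
  have "exp (b * t) * v t > 0"
  proof (rule increasing_from_bot_pos[where f = "\<lambda>t. exp (b * t) * v t" and t = t and f' = "\<lambda>t. - exp (b * t) * g (z t)" and T = T])
    show "((\<lambda>t. exp (b * t) * v t) has_real_derivative - exp (b * t) * g (z t)) (at t)" for t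
      by (auto intro!: derivative_eq_intros v_deriv simp: algebra_simps)
    show "- exp (b * t) * g (z t) > 0" if "t < T" for t
      using g_neg[OF z_greater below[OF that]] by (simp add: mult_pos_neg)
    show "((\<lambda>t. exp (b * t) * v t) \<longlongrightarrow> 0) at_bot"
      using tendsto_mult[OF exp_scaled_bot v_bot] by simp
  qed fact
  then show ?thesis by (simp add: zero_less_mult_iff)
qed

text \<open>As \<open>z\<close> tends to \<open>zr\<close>, the coefficient of the linearized
  equation tends to \<open>g' zr\<close>, which exceeds \<open>b\<^sup>2 / 4\<close>; Sturm
  comparison therefore applies on every late window.\<close>

lemma z_hits_zr: "\<exists>t\<ge>T. z t = zr"
proof -
  obtain Q where Q: "isCont Q zr" "Q zr = g' zr"
    and v': "\<And>t. (v has_real_derivative - Q (z t) * (z t - zr) - b * v t) (at t)"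
    using linearization[OF g_zr] by metis
  \<comment> \<open>\<open>\<omega>\<^sup>2\<close> is half the gap between \<open>g' zr\<close> and
    \<open>b\<^sup>2 / 4\<close>, leaving room for the coefficient to differ from its limit.\<close>
  define \<omega> where "\<omega> = sqrt ((g' zr - b\<^sup>2 / 4) / 2)"
  have \<omega>: "\<omega> > 0" "b\<^sup>2 / 4 + \<omega>\<^sup>2 < g' zr"
    using underdamped by (auto simp: \<omega>_def field_simps)
  have "((\<lambda>t. Q (z t)) \<longlongrightarrow> g' zr) at_top"
    using isCont_tendsto_compose[OF Q(1) z_top] Q(2) by simp
  then have "\<forall>\<^sub>F t in at_top. b\<^sup>2 / 4 + \<omega>\<^sup>2 < Q (z t)"
    using \<omega>(2) by (rule order_tendstoD)
  then obtain S where S: "\<And>t. t \<ge> S \<Longrightarrow> b\<^sup>2 / 4 + \<omega>\<^sup>2 < Q (z t)"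
    unfolding eventually_at_top_linorder by blast
  have "\<exists>t\<ge>max S T. z t - zr = 0"
    by (rule sturm_zero[where v = v and b = b and \<omega> = \<omega> and Q = "\<lambda>t. Q (z t)", OF _ v' \<omega>(1)])
      (auto intro!: derivative_eq_intros z_deriv intro: order.strict_implies_order[OF S])
  then show ?thesis by auto
qed

lemma v_zeros_unbounded: "\<exists>u>t. v u = 0"
proof -
  obtain p where p: "p \<ge> t" "z p = zr" using z_hits_zr by blast
  \<comment> \<open>A second, distinct passage through \<open>zr\<close>; Rolle's theorem gives a
    zero of \<open>v\<close> between the two.\<close>
  obtain q where q: "q \<ge> p + 1" "z q = zr" using z_hits_zr by blast
  obtain u where "p < u" "u < q" "(z has_real_derivative 0) (at u)"
    using Rolle[of p q z] p q isCont_z z_deriv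
    by (smt (verit) continuous_at_imp_continuous_on real_differentiable_def DERIV_unique)
  then show ?thesis using DERIV_unique[OF z_deriv] p(1) by (metis le_less_trans)
qed

section \<open>Position and height of the extrema\<close>

lemma critical_max: "v t = 0 \<Longrightarrow> - g (z t) - b * v t < 0 \<Longrightarrow> z t > zr"
  using g_neg[OF z_greater, of t] g_zr by (cases "z t" zr rule: linorder_cases) auto

lemma critical_min: "v t = 0 \<Longrightarrow> - g (z t) - b * v t > 0 \<Longrightarrow> z t < zr"
  using g_pos[of "z t"] g_zr by (cases "z t" zr rule: linorder_cases) auto

lemma energy_at_zero: "v t = 0 \<Longrightarrow> energy t = G (z t)"
  by (simp add: energy_def)

lemma G_le_energy: "G (z t) \<le> energy t"
  by (simp add: energy_def)

lemma z_increasing: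
  assumes "\<And>t. t < p \<Longrightarrow> v t > 0" and "t < u" and "u \<le> p"
  shows "z t < z u"
proof (rule DERIV_pos_imp_increasing_open[OF assms(2)])
  show "\<exists>l. (z has_real_derivative l) (at x) \<and> l > 0" if "x < u" for x
    using z_deriv assms(1)[of x] that assms(3) by (meson less_le_trans)
qed (auto intro: continuous_at_imp_continuous_on isCont_z)

text \<open>Before \<open>p\<close> the orbit climbs. After \<open>p\<close> the potential is
  bounded by an energy below \<open>G (z p)\<close>, and \<open>G\<close> increases to the right of
  \<open>zr\<close>, so the height \<open>z p\<close> is never regained.\<close>

lemma peak_unique:
  assumes zero: "v p = 0" and "z p > zr" and before: "\<And>t. t < p \<Longrightarrow> v t > 0" and "t \<noteq> p"
  shows "z t < z p"
proof (cases "t < p")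
  case True
  then show ?thesis by (intro z_increasing[OF before]) auto
next
  case False
  then have "energy t < energy p" using \<open>t \<noteq> p\<close> by (intro energy_decreasing) simp
  then have "G (z t) < G (z p)"
    using G_le_energy[of t] energy_at_zero[OF zero] by simp
  then show ?thesis
    using G_increasing[of "z p" "z t"] \<open>z p > zr\<close> by (cases "z p" "z t" rule: linorder_cases) auto
qed

text \<open>Along the first monotone branch \<open>(exp (b t) v')' = - exp (b t) g'(z) v\<close> changes sign
  exactly once, when \<open>z\<close> passes the minimum \<open>zm\<close> of \<open>g\<close>.\<close>

lemma inflection_unique:
  assumes zero: "v p = 0" and "z p > zr" and before: "\<And>t. t < p \<Longrightarrow> v t > 0"
  obtains q where "q < p" and "\<And>t. t < q \<Longrightarrow> - g (z t) - b * v t > 0"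
    and "\<And>t. q < t \<Longrightarrow> t < p \<Longrightarrow> - g (z t) - b * v t < 0"
proof -
  define H where "H t = exp (b * t) * (- g (z t) - b * v t)" for t
  have sgn_H: "H t > 0 \<longleftrightarrow> - g (z t) - b * v t > 0" "H t < 0 \<longleftrightarrow> - g (z t) - b * v t < 0" for t
    by (auto simp: H_def zero_less_mult_iff mult_less_0_iff)
  have H': "(H has_real_derivative - (exp (b * t) * g' (z t) * v t)) (at t)" for t
    unfolding H_def
    by (auto intro!: derivative_eq_intros DERIV_chain2[OF g_deriv z_deriv] v_deriv simp: algebra_simps)
  have cont: "isCont H t" for t using H' by (rule DERIV_isCont)
  have incr: "z t < z u" if "t < u" "u \<le> p" for t u
    using before that by (rule z_increasing)
  have "\<forall>\<^sub>F t in at_bot. z t < zm \<and> t \<le> p"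
    using order_tendstoD(2)[OF z_bot zl_less_zm] eventually_le_at_bot by (rule eventually_conj)
  then obtain t0 where t0: "z t0 < zm" "t0 \<le> p" using eventually_happens by fastforce
  \<comment> \<open>The climb passes \<open>zm\<close>, since it starts near \<open>zl\<close> and
    ends above \<open>zr\<close>.\<close>
  then have "\<exists>t\<ge>t0. t \<le> p \<and> z t = zm"
    using \<open>z p > zr\<close> zm_less_zr isCont_z by (intro IVT) auto
  then obtain m where m: "m \<le> p" "z m = zm" by blast
  then have "m < p" using \<open>z p > zr\<close> zm_less_zr by (cases "m = p") auto
  \<comment> \<open>Up to \<open>m\<close> the derivative of \<open>H\<close> is positive, and
    \<open>H\<close> starts from the limit 0 at minus infinity.\<close>
  have H_pos: "H t > 0" if "t \<le> m" for t
  proof (rule increasing_from_bot_pos[OF H' _ _ that])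
    show "0 < - (exp (b * t) * g' (z t) * v t)" if "t < m" for t
    proof -
      have "g' (z t) < 0" "v t > 0"
        using incr[OF that m(1)] before[of t] m that g'_neg by auto
      then show ?thesis by (simp add: mult_less_0_iff)
    qed
    have "((\<lambda>t. exp (b * t) * (- g (z t) - b * v t)) \<longlongrightarrow> 0 * (- g zl - b * 0)) at_bot"
      by (intro tendsto_intros isCont_tendsto_compose[OF isCont_g] z_bot v_bot exp_scaled_bot)
    then show "(H \<longlongrightarrow> 0) at_bot" by (simp add: H_def[abs_def])
  qed
  have H_decr: "H u < H t" if "m \<le> t" "t < u" "u \<le> p" for t u
  proof (rule DERIV_neg_imp_decreasing_open[OF that(2)])
    fix x assume x: "t < x" "x < u"
    have "z m < z x" "v x > 0"
      using x that by (auto intro!: incr before)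
    then have "g' (z x) > 0" "v x > 0" using m g'_pos by auto
    then have "- (exp (b * x) * g' (z x) * v x) < 0" by simp
    then show "\<exists>l. (H has_real_derivative l) (at x) \<and> l < 0" using H' by blast
  qed (auto intro!: continuous_at_imp_continuous_on cont)
  \<comment> \<open>From \<open>m\<close> to \<open>p\<close> the function \<open>H\<close>
    decreases strictly from a positive to a negative value, so its zero \<open>q\<close> is the only
    sign change.\<close>
  have "H p < 0" using g_pos[OF \<open>z p > zr\<close>] zero by (simp add: sgn_H)
  have "\<exists>q\<ge>m. q \<le> p \<and> H q = 0"
    using H_pos[of m] \<open>H p < 0\<close> \<open>m < p\<close> cont by (intro IVT2) auto
  then obtain q where q: "m \<le> q" "q \<le> p" "H q = 0" by blast
  have "q < p" using q \<open>H p < 0\<close> by (cases "q = p") auto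
  moreover have "H t > 0" if "t < q" for t
    using H_pos[of t] H_decr[of t q] q that by (cases "t \<le> m") auto
  moreover have "H t < 0" if "q < t" "t < p" for t
    using H_decr[of q t] q that by simp
  ultimately show thesis using that sgn_H by blast
qed

theorem oscillation:
  "(\<forall>t. z t > zl) \<and>
    bdd_above (range z) \<and>
    (\<exists>p. z p = (SUP t. z t) \<and> (\<forall>t. z t = (SUP t. z t) \<longrightarrow> t = p) \<and>
      (\<forall>t<p. deriv z t > 0) \<and>
      (\<exists>q<p. \<forall>t<p. t \<noteq> q \<longrightarrow> (t - q) * deriv (deriv z) t < 0) \<and>
      infinite {t. local_max_at z t} \<and> infinite {t. local_min_at z t} \<and>
      (\<exists>\<chi>s \<omega>s :: nat \<Rightarrow> real.
        \<chi>s 0 = p \<and>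
        {t. local_max_at z t} = range \<chi>s \<and>
        {t. local_min_at z t} = \<omega>s ` {1..} \<and>
        (\<forall>i. \<chi>s i < \<omega>s (i + 1) \<and> \<omega>s (i + 1) < \<chi>s (i + 1)) \<and>
        filterlim \<chi>s at_top sequentially \<and>
        filterlim \<omega>s at_top sequentially \<and>
        (\<forall>i. zr < z (\<chi>s (i + 1)) \<and> z (\<chi>s (i + 1)) < z (\<chi>s i)) \<and>
        (\<forall>i\<ge>1. zr > z (\<omega>s (i + 1)) \<and> z (\<omega>s (i + 1)) > z (\<omega>s i))))"
proof -
  define acc where "acc t = - g (z t) - b * v t" for t
  have v': "(v has_real_derivative acc t) (at t)" for t
    unfolding acc_def by (rule v_deriv)
  have simple: "acc t \<noteq> 0" if "v t = 0" for t
    using no_equilibrium[OF that] that by (simp add: acc_def)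
  have "\<forall>\<^sub>F t in at_bot. z t < zr"
    using order_tendstoD(2)[OF z_bot] zl_less_zm zm_less_zr by simp
  then obtain T where T: "\<And>t. t \<le> T \<Longrightarrow> z t < zr"
    unfolding eventually_at_bot_linorder by blast
  \<comment> \<open>Near minus infinity \<open>z\<close> is still below \<open>zr\<close>, so the
    zeros of \<open>v\<close> are bounded below and have a first element.\<close>
  have start: "v t > 0" if "t < T" for t
    using that T by (intro v_pos_before[of T]) auto
  obtain c where c: "strict_mono c" "filterlim c at_top sequentially" "range c = {t. v t = 0}"
    "\<And>t. t < c 0 \<Longrightarrow> v t > 0" "\<And>n. even n \<Longrightarrow> acc (c n) < 0" "\<And>n. odd n \<Longrightarrow> acc (c n) > 0"
    using simple_zeros_enumeration[OF v' simple start v_zeros_unbounded] by blast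
  have v_c: "v (c n) = 0" for n using c(3) by auto
  have above: "z (c n) > zr" if "even n" for n
    using critical_max[OF v_c] c(5)[OF that] by (simp add: acc_def)
  have below: "z (c n) < zr" if "odd n" for n
    using critical_min[OF v_c] c(6)[OF that] by (simp add: acc_def)
  have G_c: "G (z (c n)) < G (z (c m))" if "m < n" for m n
    using energy_decreasing[OF strict_monoD[OF c(1) that]] by (simp add: energy_at_zero v_c)
  \<comment> \<open>\<open>v\<close> first crosses zero downward, so even indices are maxima and odd
    ones minima. Minima are numbered from 1; truncated subtraction makes
    \<open>\<omega>s 0 = c 0\<close>, a dummy value outside the enumeration over
    \<open>{1..}\<close>.\<close>
  define \<chi>s where "\<chi>s i = c (2 * i)" for i
  define \<omega>s where "\<omega>s i = c (2 * i - 1)" for i :: nat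
  have peak: "z t < z (\<chi>s 0)" if "t \<noteq> \<chi>s 0" for t
    using peak_unique[OF v_c[of 0] _ c(4) that[unfolded \<chi>s_def, simplified]] above[of 0]
    by (simp add: \<chi>s_def)
  have bdd: "bdd_above (range z)"
    using peak by (intro bdd_aboveI2[of _ _ "z (\<chi>s 0)"]) (metis less_imp_le order_refl)
  have sup: "(SUP t. z t) = z (\<chi>s 0)"
    using peak by (intro cSup_eq_maximum) (auto, metis less_imp_le order_refl)
  have deriv_z: "deriv z = v" and deriv_v: "deriv v = acc"
    using z_deriv v' by (auto intro!: DERIV_imp_deriv)
  obtain q where q: "q < \<chi>s 0" "\<And>t. t < q \<Longrightarrow> acc t > 0" "\<And>t. q < t \<Longrightarrow> t < \<chi>s 0 \<Longrightarrow> acc t < 0"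
    using inflection_unique[OF v_c[of 0] _ c(4)] above[of 0] by (auto simp: \<chi>s_def acc_def)
  have inflection: "(t - q) * acc t < 0" if "t < \<chi>s 0" "t \<noteq> q" for t
    using q(2)[of t] q(3)[of t] that by (cases "t < q") (auto simp: mult_less_0_iff)
  have maxima: "{t. local_max_at z t} = range \<chi>s"
  proof -
    have "{t. local_max_at z t} = {t \<in> range c. acc t < 0}"
      using local_max_at_iff_critical[OF z_deriv v' simple] c(3) by auto
    also have "\<dots> = range \<chi>s"
    proof (intro equalityI subsetI)
      fix t assume t: "t \<in> {t \<in> range c. acc t < 0}"
      then obtain n where n: "t = c n" by blast
      have "even n" using c(6)[of n] t n by force
      then show "t \<in> range \<chi>s" using n by (auto simp: \<chi>s_def elim!: evenE)
    next
      fix t assume "t \<in> range \<chi>s"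
      then show "t \<in> {t \<in> range c. acc t < 0}" using c(5) by (auto simp: \<chi>s_def)
    qed
    finally show ?thesis .
  qed
  have minima: "{t. local_min_at z t} = \<omega>s ` {1..}"
  proof -
    have "{t. local_min_at z t} = {t \<in> range c. acc t > 0}"
      using local_min_at_iff_critical[OF z_deriv v' simple] c(3) by auto
    also have "\<dots> = \<omega>s ` {1..}"
    proof (intro equalityI subsetI)
      fix t assume t: "t \<in> {t \<in> range c. acc t > 0}"
      then obtain n where n: "t = c n" by blast
      have "odd n" using c(5)[of n] t n by force
      then obtain k where "n = 2 * k + 1" by (elim oddE)
      then have "t = \<omega>s (k + 1)" using n by (simp add: \<omega>s_def)
      then show "t \<in> \<omega>s ` {1..}" by auto
    next
      fix t assume "t \<in> \<omega>s ` {1..}"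
      then show "t \<in> {t \<in> range c. acc t > 0}" using c(6) by (auto simp: \<omega>s_def)
    qed
    finally show ?thesis .
  qed
  have inter: "\<chi>s i < \<omega>s (i + 1)" "\<omega>s (i + 1) < \<chi>s (i + 1)" for i
    by (auto simp: \<chi>s_def \<omega>s_def intro!: strict_monoD[OF c(1)])
  have lim_\<chi>s: "filterlim \<chi>s at_top sequentially"
    unfolding \<chi>s_def
    by (rule filterlim_compose[OF c(2)]) (auto intro!: filterlim_subseq strict_monoI)
  have lim_\<omega>s: "filterlim \<omega>s at_top sequentially"
  proof (rule filterlim_at_top_mono[OF c(2)])
    \<comment> \<open>For \<open>i \<ge> 1\<close> the index satisfies
      \<open>i \<le> 2 * i - 1\<close>, and \<open>c\<close> is increasing.\<close>
    show "\<forall>\<^sub>F i in sequentially. c i \<le> \<omega>s i"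
      using eventually_ge_at_top[of 1]
      by eventually_elim (auto simp: \<omega>s_def strict_mono_less_eq[OF c(1)])
  qed
  \<comment> \<open>At zeros of \<open>v\<close> the energy equals \<open>G (z t)\<close>. Smaller
    potential means smaller height to the right of \<open>zr\<close>, where \<open>G\<close>
    increases, and greater height to its left, where \<open>G\<close> decreases.\<close>
  have heights_max: "z (\<chi>s (i + 1)) < z (\<chi>s i)" for i
    using G_c[of "2 * i" "2 * i + 2"] G_increasing[of "z (\<chi>s i)" "z (\<chi>s (i + 1))"] above[of "2 * i"]
    by (cases "z (\<chi>s i)" "z (\<chi>s (i + 1))" rule: linorder_cases) (auto simp: \<chi>s_def)
  have heights_min: "z (\<omega>s (i + 1)) > z (\<omega>s i)" if "i \<ge> 1" for i
  proof -
    have "G (z (\<omega>s (i + 1))) < G (z (\<omega>s i))"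
      by (auto simp: \<omega>s_def intro!: G_c)
    moreover have "z (\<omega>s i) < zr" using below[of "2 * i - 1"] that by (simp add: \<omega>s_def)
    ultimately show ?thesis
      using G_decreasing[of "z (\<omega>s (i + 1))" "z (\<omega>s i)"] z_greater
      by (cases "z (\<omega>s i)" "z (\<omega>s (i + 1))" rule: linorder_cases) (auto simp: less_imp_le)
  qed
  have "inj \<chi>s" using c(1) by (auto simp: inj_def \<chi>s_def strict_mono_eq)
  moreover have "inj_on \<omega>s {1..}" using c(1) by (auto simp: inj_on_def \<omega>s_def strict_mono_eq)
  ultimately have inf: "infinite (range \<chi>s)" "infinite (\<omega>s ` {1..})"
    by (simp_all add: finite_image_iff infinite_Ici)
  have tails: "z (\<chi>s (i + 1)) > zr" "z (\<omega>s (i + 1)) < zr" for i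
    using above[of "2 * (i + 1)"] below[of "2 * (i + 1) - 1"] by (auto simp: \<chi>s_def \<omega>s_def)
  have concave: "\<exists>q<\<chi>s 0. \<forall>t<\<chi>s 0. t \<noteq> q \<longrightarrow> (t - q) * acc t < 0"
    using q(1) inflection by blast
  show ?thesis
    unfolding deriv_z deriv_v sup maxima minima
  proof (rule conjI, use z_greater in blast, rule conjI, rule bdd, rule exI[of _ "\<chi>s 0"],
      intro conjI refl concave inf)
    show "\<forall>t. z t = z (\<chi>s 0) \<longrightarrow> t = \<chi>s 0" using peak by force
    show "\<forall>t<\<chi>s 0. v t > 0" using c(4) by (simp add: \<chi>s_def)
  qed (rule exI[of _ \<chi>s], rule exI[of _ \<omega>s],
      use inter lim_\<chi>s lim_\<omega>s heights_max heights_min tails in \<open>auto simp del: One_nat_def; fastforce\<close>)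
qed

end

section \<open>The travelling wave system\<close>

text \<open>Multiplied by \<open>\<zeta>l\<close>, the lower bound on \<open>s\<close> says that
  \<open>- K1\<close> exceeds \<open>sqrt \<zeta>l * \<zeta>l\<close>; squaring gives the claim,
  which is what separates the two equilibria.\<close>

lemma K1_squared_greater:
  assumes "\<zeta>l > 0" and "s > sqrt \<zeta>l + wl / \<zeta>l"
  shows "(K1 \<zeta>l wl s)\<^sup>2 > \<zeta>l ^ 3"
proof -
  have "sqrt \<zeta>l * \<zeta>l < s * \<zeta>l - wl"
    using mult_strict_right_mono[OF assms(2,1)] assms(1) by (simp add: distrib_right)
  moreover have "0 \<le> sqrt \<zeta>l * \<zeta>l" using assms(1) by simp
  ultimately have "(sqrt \<zeta>l * \<zeta>l)\<^sup>2 < (s * \<zeta>l - wl)\<^sup>2"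
    by (intro power_strict_mono) auto
  moreover have "(sqrt \<zeta>l * \<zeta>l)\<^sup>2 = \<zeta>l ^ 3"
    using assms(1) by (simp add: power_mult_distrib power3_eq_cube power2_eq_square)
  ultimately show ?thesis by (simp add: K1_def power2_commute)
qed

section \<open>Zeros and derivative of \<open>F\<close>\<close>

lemma K2_minus_K1:
  assumes "\<zeta>l > 0"
  shows "K2 \<zeta>l wl s - s * K1 \<zeta>l wl s = (K1 \<zeta>l wl s)\<^sup>2 / \<zeta>l + \<zeta>l\<^sup>2 / 2"
  using assms by (simp add: K1_def K2_def field_simps power2_eq_square)

lemma zeta_r_greater:
  assumes "\<zeta>l > 0" and "(K1 \<zeta>l wl s)\<^sup>2 > \<zeta>l ^ 3"
  shows "zeta_r \<zeta>l wl s > \<zeta>l"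
proof -
  \<comment> \<open>\<open>3 * \<zeta>l\<close> is the value of the square root at which
    \<open>zeta_r\<close> would equal \<open>\<zeta>l\<close>.\<close>
  have "(3 * \<zeta>l)\<^sup>2 < (8 * (K1 \<zeta>l wl s)\<^sup>2 + \<zeta>l ^ 3) / \<zeta>l"
    using assms by (simp add: field_simps power2_eq_square power3_eq_cube)
  then have "3 * \<zeta>l < sqrt ((8 * (K1 \<zeta>l wl s)\<^sup>2 + \<zeta>l ^ 3) / \<zeta>l)"
    by (rule real_less_rsqrt)
  then show ?thesis by (simp add: zeta_r_def)
qed

text \<open>This is the quadratic factor of the numerator of \<open>F\<close> that remains after
  \<open>\<zeta> - \<zeta>l\<close> is split off. In this form it eliminates \<open>K1\<close>
  without square roots.\<close>

lemma zeta_r_quadratic: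
  assumes "\<zeta>l > 0"
  shows "\<zeta>l * zeta_r \<zeta>l wl s * (zeta_r \<zeta>l wl s + \<zeta>l) = 2 * (K1 \<zeta>l wl s)\<^sup>2"
proof -
  have "0 \<le> (8 * (K1 \<zeta>l wl s)\<^sup>2 + \<zeta>l ^ 3) / \<zeta>l" using assms by simp
  then have "(2 * zeta_r \<zeta>l wl s + \<zeta>l)\<^sup>2 = (8 * (K1 \<zeta>l wl s)\<^sup>2 + \<zeta>l ^ 3) / \<zeta>l"
    by (simp add: zeta_r_def)
  then show ?thesis
    using assms by (simp add: field_simps power2_eq_square power3_eq_cube)
qed

lemma F_zeta_l:
  assumes "\<zeta>l > 0"
  shows "F \<zeta>l wl s \<zeta>l = 0"
  using assms unfolding F_def K2_minus_K1[OF assms] by (simp add: field_simps power2_eq_square)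

lemma F_zeta_r:
  assumes "\<zeta>l > 0" and "zeta_r \<zeta>l wl s > 0"
  shows "F \<zeta>l wl s (zeta_r \<zeta>l wl s) = 0"
proof -
  define r where "r = zeta_r \<zeta>l wl s"
  have K: "(K1 \<zeta>l wl s)\<^sup>2 = \<zeta>l * r * (r + \<zeta>l) / 2"
    using zeta_r_quadratic[OF assms(1), of wl s] by (simp add: r_def)
  have "r > 0" using assms(2) by (simp add: r_def)
  then have "F \<zeta>l wl s r = 0"
    using assms(1) unfolding F_def K2_minus_K1[OF assms(1)] K
    by (simp add: field_simps power2_eq_square)
  then show ?thesis by (simp add: r_def)
qed

lemma F_deriv:
  assumes "x \<noteq> 0"
  shows "(F \<zeta>l wl s has_real_derivative
    1 / 2 - 2 * (K1 \<zeta>l wl s)\<^sup>2 / x ^ 3 + (K2 \<zeta>l wl s - s * K1 \<zeta>l wl s) / x\<^sup>2) (at x)"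
proof -
  have "((\<lambda>x. x / 2 + (K1 \<zeta>l wl s)\<^sup>2 / x\<^sup>2 - (K2 \<zeta>l wl s - s * K1 \<zeta>l wl s) / x) has_real_derivative
    1 / 2 - 2 * (K1 \<zeta>l wl s)\<^sup>2 / x ^ 3 + (K2 \<zeta>l wl s - s * K1 \<zeta>l wl s) / x\<^sup>2) (at x)"
    using assms
    by (auto intro!: derivative_eq_intros simp: field_simps power2_eq_square power3_eq_cube)
  then show ?thesis unfolding F_def[abs_def] .
qed

theorem theorem4p2:
  fixes \<epsilon> \<delta> \<zeta>l wl s :: real and z v :: "real \<Rightarrow> real"
  assumes "\<epsilon> > 0" and "\<delta> > 0" and "\<zeta>l > 0" and "s > 0"
    and "s > sqrt \<zeta>l + wl / \<zeta>l"
    and "\<epsilon>\<^sup>2 < 4 * \<delta> * (K1 \<zeta>l wl s)\<^sup>2 / (3 * s\<^sup>2)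
              * deriv (F \<zeta>l wl s) (zeta_r \<zeta>l wl s) * zeta_r \<zeta>l wl s"
    and "wave_solution \<epsilon> \<delta> \<zeta>l wl s z v"
    and "\<not> (\<exists>p. \<forall>\<xi>. (z \<xi>, v \<xi>) = p)"
    and "((\<lambda>\<xi>. (z \<xi>, v \<xi>)) \<longlongrightarrow> (ln \<zeta>l, 0)) at_bot"
    and "((\<lambda>\<xi>. (z \<xi>, v \<xi>)) \<longlongrightarrow> (ln (zeta_r \<zeta>l wl s), 0)) at_top"
  shows "(\<forall>\<xi>. z \<xi> > ln \<zeta>l) \<and>
    bdd_above (range z) \<and>
    (\<exists>\<chi>0.
      \<comment> \<open>(a)\<close>
      z \<chi>0 = (SUP \<xi>. z \<xi>) \<and> (\<forall>\<xi>. z \<xi> = (SUP \<xi>. z \<xi>) \<longrightarrow> \<xi> = \<chi>0) \<and>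
      (\<forall>\<xi><\<chi>0. deriv z \<xi> > 0) \<and>
      \<comment> \<open>(b)\<close>
      (\<exists>\<xi>0<\<chi>0. \<forall>\<xi><\<chi>0. \<xi> \<noteq> \<xi>0 \<longrightarrow> (\<xi> - \<xi>0) * deriv (deriv z) \<xi> < 0) \<and>
      \<comment> \<open>(c)\<close>
      infinite {\<xi>. local_max_at z \<xi>} \<and> infinite {\<xi>. local_min_at z \<xi>} \<and>
      (\<exists>\<chi>s \<omega>s :: nat \<Rightarrow> real.
        \<chi>s 0 = \<chi>0 \<and>
        {\<xi>. local_max_at z \<xi>} = range \<chi>s \<and>
        {\<xi>. local_min_at z \<xi>} = \<omega>s ` {1..} \<and>
        (\<forall>i. \<chi>s i < \<omega>s (i + 1) \<and> \<omega>s (i + 1) < \<chi>s (i + 1)) \<and>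
        filterlim \<chi>s at_top sequentially \<and>
        filterlim \<omega>s at_top sequentially \<and>
        (\<forall>i. ln (zeta_r \<zeta>l wl s) < z (\<chi>s (i + 1)) \<and> z (\<chi>s (i + 1)) < z (\<chi>s i)) \<and>
        (\<forall>i\<ge>1. ln (zeta_r \<zeta>l wl s) > z (\<omega>s (i + 1)) \<and> z (\<omega>s (i + 1)) > z (\<omega>s i))))"
proof -
  define K where "K = K1 \<zeta>l wl s"
  define P where "P = K2 \<zeta>l wl s - s * K1 \<zeta>l wl s"
  define r where "r = zeta_r \<zeta>l wl s"
  define a where "a = 3 / K\<^sup>2"
  define b where "b = 3 * wave_c \<epsilon> \<delta> s / K\<^sup>2"
  define g where "g x = a * F \<zeta>l wl s (exp x)" for x
  \<comment> \<open>Antiderivative of \<open>g\<close>, obtained by integrating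
    \<open>F (exp x)\<close> as a combination of \<open>exp x\<close>, \<open>exp (- 2 * x)\<close>
    and \<open>exp (- x)\<close>.\<close>
  define G where "G x = a * (exp x / 2 - K\<^sup>2 / (2 * (exp x)\<^sup>2) + P / exp x)" for x
  \<comment> \<open>\<open>\<phi> \<zeta>\<close> is \<open>\<zeta> ^ 3\<close> times the derivative
    of \<open>F\<close> at \<open>\<zeta>\<close>: it has the same sign for positive
    \<open>\<zeta>\<close> and, as \<open>P > 0\<close>, is strictly increasing there.\<close>
  define \<phi> where "\<phi> \<zeta> = \<zeta> ^ 3 / 2 + P * \<zeta> - 2 * K\<^sup>2" for \<zeta>
  define g' where "g' x = a / (exp x)\<^sup>2 * \<phi> (exp x)" for x
  have Kl: "K\<^sup>2 > \<zeta>l ^ 3" unfolding K_def by (rule K1_squared_greater) fact+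
  moreover have "\<zeta>l ^ 3 > 0" using \<open>\<zeta>l > 0\<close> by simp
  ultimately have K_pos: "K\<^sup>2 > 0" by linarith
  then have a_pos: "a > 0" by (simp add: a_def)
  have r: "r > \<zeta>l" "r > 0"
    using zeta_r_greater[of \<zeta>l wl s] \<open>\<zeta>l > 0\<close> Kl by (auto simp: r_def K_def)
  have "P > 0"
    unfolding P_def K2_minus_K1[OF \<open>\<zeta>l > 0\<close>] using \<open>\<zeta>l > 0\<close> by (simp add: add_nonneg_pos)
  have g_deriv: "(g has_real_derivative g' x) (at x)" for x
    unfolding g_def g'_def \<phi>_def
    by (auto intro!: derivative_eq_intros DERIV_chain2[OF F_deriv DERIV_exp]
        simp: K_def P_def field_simps power2_eq_square power3_eq_cube)
  have G_deriv: "(G has_real_derivative g x) (at x)" for x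
    unfolding g_def G_def F_def
    by (auto intro!: derivative_eq_intros simp: K_def P_def field_simps power2_eq_square)
  have g_zero: "g (ln \<zeta>l) = 0" "g (ln r) = 0"
    using F_zeta_l[of \<zeta>l wl s] F_zeta_r[of \<zeta>l wl s] \<open>\<zeta>l > 0\<close> r by (auto simp: g_def r_def)
  \<comment> \<open>Since \<open>g\<close> vanishes at both equilibria, \<open>g'\<close> has a zero
    between them; monotonicity of \<open>\<phi>\<close> fixes the sign of \<open>g'\<close> on
    either side.\<close>
  obtain m where m: "ln \<zeta>l < m" "m < ln r" "g' m = 0"
    using MVT2[of "ln \<zeta>l" "ln r" g g'] g_deriv g_zero r \<open>\<zeta>l > 0\<close> by auto
  have \<phi>_mono: "\<phi> x < \<phi> y" if "0 < x" "x < y" for x y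
    using that \<open>P > 0\<close> power_strict_mono[of x y 3] by (simp add: \<phi>_def add_strict_mono)
  have "\<phi> (exp m) = 0" using m(3) a_pos by (simp add: g'_def)
  then have \<phi>_sgn: "x < m \<Longrightarrow> \<phi> (exp x) < 0" "m < x \<Longrightarrow> \<phi> (exp x) > 0" for x
    using \<phi>_mono[of "exp x" "exp m"] \<phi>_mono[of "exp m" "exp x"] by auto
  have g'_r: "g' (ln r) = a * deriv (F \<zeta>l wl s) r * r"
    using r by (simp add: g'_def \<phi>_def DERIV_imp_deriv[OF F_deriv] K_def P_def
        field_simps power2_eq_square power3_eq_cube)
  have c_pos: "wave_c \<epsilon> \<delta> s > 0" and c_sq: "(wave_c \<epsilon> \<delta> s)\<^sup>2 = s\<^sup>2 * \<epsilon>\<^sup>2 / \<delta>"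
    using \<open>\<epsilon> > 0\<close> \<open>\<delta> > 0\<close> \<open>s > 0\<close>
    by (auto simp: wave_c_def power_mult_distrib power_divide)
  have under: "b\<^sup>2 < 4 * g' (ln r)"
  proof -
    \<comment> \<open>Multiplying the bound on \<open>\<epsilon>\<^sup>2\<close> by
      \<open>s\<^sup>2 / \<delta>\<close> turns its left side into the square of
      \<open>wave_c\<close>; the further factor \<open>(3 / K\<^sup>2)\<^sup>2\<close> turns it into
      \<open>b\<^sup>2\<close>.\<close>
    have "s\<^sup>2 * \<epsilon>\<^sup>2 / \<delta> < s\<^sup>2 * (4 * \<delta> * K\<^sup>2 / (3 * s\<^sup>2) * deriv (F \<zeta>l wl s) r * r) / \<delta>"
      using assms(6) \<open>\<delta> > 0\<close> \<open>s > 0\<close>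
      by (intro divide_strict_right_mono mult_strict_left_mono) (auto simp: K_def r_def)
    also have "\<dots> = 4 * K\<^sup>2 / 3 * (deriv (F \<zeta>l wl s) r * r)"
      using \<open>\<delta> > 0\<close> \<open>s > 0\<close> by (simp add: field_simps)
    finally have "(3 / K\<^sup>2)\<^sup>2 * (wave_c \<epsilon> \<delta> s)\<^sup>2
        < (3 / K\<^sup>2)\<^sup>2 * (4 * K\<^sup>2 / 3 * (deriv (F \<zeta>l wl s) r * r))"
      unfolding c_sq using K_pos by (intro mult_strict_left_mono) auto
    moreover have "b\<^sup>2 = (3 / K\<^sup>2)\<^sup>2 * (wave_c \<epsilon> \<delta> s)\<^sup>2"
      by (simp add: b_def power_mult_distrib power_divide)
    moreover have "(3 / K\<^sup>2)\<^sup>2 * (4 * K\<^sup>2 / 3 * (deriv (F \<zeta>l wl s) r * r)) = 4 * g' (ln r)"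
      using K_pos by (simp add: g'_r a_def field_simps power2_eq_square)
    ultimately show ?thesis by (simp only:)
  qed
  interpret damped_heteroclinic g g' G b "ln \<zeta>l" m "ln r" z v
  proof
    show "(g has_real_derivative g' x) (at x)" "(G has_real_derivative g x) (at x)" for x
      by (rule g_deriv G_deriv)+
    show "g' x < 0" if "x < m" for x
      using \<phi>_sgn(1)[OF that] a_pos by (simp add: g'_def divide_neg_pos mult_pos_neg)
    show "g' x > 0" if "m < x" for x
      using \<phi>_sgn(2)[OF that] a_pos by (simp add: g'_def)
    show "b > 0" using c_pos K_pos by (simp add: b_def)
    show "(z has_real_derivative v t) (at t)" for t
      using assms(7) by (simp add: wave_solution_def)
    show "(v has_real_derivative - g (z t) - b * v t) (at t)" for t
      using assms(7) by (simp add: wave_solution_def g_def a_def b_def K_def)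
    show "(z \<longlongrightarrow> ln \<zeta>l) at_bot" "(v \<longlongrightarrow> 0) at_bot"
      using tendsto_fst[OF assms(9)] tendsto_snd[OF assms(9)] by simp_all
    show "(z \<longlongrightarrow> ln r) at_top"
      using tendsto_fst[OF assms(10)] by (simp add: r_def)
  qed (use g_zero m under in auto)
  show ?thesis using oscillation unfolding r_def .
qed

end
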